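(* Let $n\ge1$ be an integer, $\alpha>n+\frac12$ and $1\le p<2(\alpha-n)$. For any smooth function $f:\mathbb{R}^n\to\mathbb{R}$, $$\int_{\mathbb{R}^n\times\mathbb{R}^n}|f(x)-f(y)|^p\,d\mathfrak{m}_{2n,\alpha}(x,y)\le C\Big(\frac{\pi}{2}\Big)^p\int_{\mathbb{R}^n}|\nabla f(x)|^p\,d\mathfrak{m}_{n,\beta}(x),$$ where $\beta=\alpha-\frac{n+p}{2}$ and $$C=\frac{1}{\sqrt{\pi}}\,\frac{\Gamma(\frac{p+1}{2})\,\Gamma(\alpha-n-\frac p2)}{\Gamma(\alpha-n)}.$$
   Context: For an integer $k\ge1$ and a real $\alpha>\frac k2$, the Cauchy measure $\mathfrak{m}_{k,\alpha}$ of order $\alpha$ on $\mathbb{R}^k$ is the probability measure with density $\frac{1}{c_{k,\alpha}}(1+|x|^2)^{-\alpha}$, $x\in\mathbb{R}^k$, with respect to Lebesgue measure, where $c_{k,\alpha}=\pi^{k/2}\,\Gamma(\alpha-\frac k2)/\Gamma(\alpha)$ and $|\cdot|$ is the Euclidean norm. The measure $\mathfrak{m}_{2n,\alpha}$ is regarded as a measure on $\mathbb{R}^n\times\mathbb{R}^n=\mathbb{R}^{2n}$, with density $\frac{1}{c_{2n,\alpha}}(1+|x|^2+|y|^2)^{-\alpha}$. *)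

theory Defs
  imports "HOL-Analysis.Analysis"
begin

text \<open>
  The dimension \<open>k\<close> is \<open>DIM('a)\<close>. On a product type, \<open>norm (x, y) ^ 2 = norm x ^ 2 + norm y ^ 2\<close>
  and \<open>lborel\<close> is the product Lebesgue measure, so at type \<open>(real ^ 'n) \<times> (real ^ 'n)\<close> this is the
  Cauchy measure on \<open>2 n\<close>-dimensional space. It is a probability measure for \<open>\<alpha> > DIM('a) / 2\<close>.
\<close>

definition cauchy_const :: "nat \<Rightarrow> real \<Rightarrow> real"
  where "cauchy_const k \<alpha> = pi powr (real k / 2) * Gamma (\<alpha> - real k / 2) / Gamma \<alpha>"

definition cauchy_measure :: "real \<Rightarrow> 'a::euclidean_space measure"
  where "cauchy_measure \<alpha> =
    density lborel (\<lambda>x. ennreal ((1 + (norm x)\<^sup>2) powr (- \<alpha>) / cauchy_const DIM('a) \<alpha>))"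

definition gradient :: "(real ^ 'n \<Rightarrow> real) \<Rightarrow> real ^ 'n \<Rightarrow> real ^ 'n"
  where "gradient f x = (\<chi> i. frechet_derivative f (at x) (axis i 1))"

lemma GDERIV_gradient:
  fixes f :: "real ^ 'n \<Rightarrow> real"
  assumes "f differentiable (at x)"
  shows "GDERIV f x :> gradient f x"
proof -
  have D: "(f has_derivative frechet_derivative f (at x)) (at x)"
    using assms frechet_derivative_works by blast
  then have lin: "linear (frechet_derivative f (at x))"
    using has_derivative_linear by blast
  have "frechet_derivative f (at x) = (\<lambda>h. h \<bullet> gradient f x)"
  proof
    fix h :: "real ^ 'n"
    have "frechet_derivative f (at x) h = frechet_derivative f (at x) (\<Sum>i\<in>UNIV. h $ i *\<^sub>R axis i 1)"
      by (metis basis_expansion scalar_mult_eq_scaleR)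
    also have "\<dots> = (\<Sum>i\<in>UNIV. h $ i *\<^sub>R frechet_derivative f (at x) (axis i 1))"
      using lin by (simp add: linear_sum linear_cmul)
    finally show "frechet_derivative f (at x) h = h \<bullet> gradient f x"
      by (simp add: gradient_def inner_vec_def)
  qed
  with D show ?thesis by (simp add: gderiv_def)
qed

text \<open>
  \<open>C_order m f\<close> says that \<open>f\<close> is \<open>m\<close> times continuously differentiable on the whole space,
  in terms of iterated directional derivatives.
\<close>

primrec C_order :: "nat \<Rightarrow> ('a::euclidean_space \<Rightarrow> real) \<Rightarrow> bool"
  where
    "C_order 0 f \<longleftrightarrow> continuous_on UNIV f"
  | "C_order (Suc m) f \<longleftrightarrow>
      (\<forall>x. f differentiable (at x)) \<and> (\<forall>v. C_order m (\<lambda>x. frechet_derivative f (at x) v))"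

definition smooth :: "('a::euclidean_space \<Rightarrow> real) \<Rightarrow> bool"
  where "smooth f \<longleftrightarrow> (\<forall>m. C_order m f)"

end

theory Submission
  imports Defs
begin

text \<open>
  The proof is Pisier's rotation argument for Gaussian measures, carried over to Cauchy measures.
  For \<open>(x, y)\<close> in the product, the curve \<open>x\<^sub>\<theta> = cos \<theta> x + sin \<theta> y\<close> joins \<open>x\<close> to \<open>y\<close> as \<open>\<theta>\<close> runs
  from \<open>0\<close> to \<open>pi / 2\<close>, with velocity \<open>y\<^sub>\<theta> = cos \<theta> y - sin \<theta> x\<close>. Writing \<open>f y - f x\<close> as the integral of
  \<open>gradient f x\<^sub>\<theta> \<bullet> y\<^sub>\<theta>\<close> and applying Jensen's inequality bounds \<open>\<bar>f x - f y\<bar> powr p\<close> by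
  \<open>(pi / 2) powr (p - 1)\<close> times the integral of \<open>\<bar>gradient f x\<^sub>\<theta> \<bullet> y\<^sub>\<theta>\<bar> powr p\<close> over the angle
  (\<open>powr_diff_le_nn_integral_rotation\<close>).

  The map from \<open>(x, y)\<close> to \<open>(x\<^sub>\<theta>, y\<^sub>\<theta>)\<close> is orthogonal and the density of the Cauchy measure on the
  product is radial. Hence the mean of \<open>\<bar>gradient f x\<^sub>\<theta> \<bullet> y\<^sub>\<theta>\<bar> powr p\<close> does not depend on \<open>\<theta>\<close>, and the
  angle contributes only a further factor \<open>pi / 2\<close> (\<open>nn_integral_rotation_average\<close>). It
  remains to integrate \<open>\<bar>gradient f x \<bullet> y\<bar> powr p\<close>. For fixed \<open>x\<close>, dilating \<open>y\<close> by
  \<open>sqrt (1 + \<bar>x\<bar>\<^sup>2)\<close> and rotating the gradient onto a coordinate axis gives an explicit moment times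
  \<open>\<bar>gradient f x\<bar> powr p * (1 + \<bar>x\<bar>\<^sup>2) powr (- \<beta>)\<close> (\<open>nn_integral_cauchy_slice\<close>), the unnormalised
  integrand on the right. This step is an equality. The moment is found by writing the Cauchy weight
  as a mixture of Gaussians (\<open>nn_integral_cauchy_weight_moment\<close>), and together with the two
  normalising constants it gives \<open>C\<close>.

  All integrals are of nonnegative functions and take values in \<open>[0, \<infinity>]\<close>, so Tonelli's theorem
  justifies every exchange, also when the right side is infinite.
\<close>

section \<open>Orthogonal invariance of Lebesgue measure\<close>

lemma nn_integral_lborel_affine:
  fixes F :: "'a::euclidean_space \<Rightarrow> ennreal"
  assumes [measurable]: "F \<in> borel_measurable borel" and c: "c \<noteq> 0"
  shows "(\<integral>\<^sup>+x. F x \<partial>lborel) = ennreal (\<bar>c\<bar> ^ DIM('a)) * (\<integral>\<^sup>+x. F (t + c *\<^sub>R x) \<partial>lborel)"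
  by (subst lborel_affine[OF c, of t])
     (simp add: nn_integral_density nn_integral_distr nn_integral_cmult)

text \<open>
  The usual proof that translation-invariant measures are unique, applied to Lebesgue measure and
  its image under \<open>T\<close>. Multiply the left side by the volume \<open>G\<close> of the unit ball and apply Fubini's
  theorem twice: translation invariance moves \<open>T y\<close> from the argument of \<open>F\<close> to that of the
  indicator \<open>B\<close> of the ball. As \<open>B\<close> is invariant under \<open>T\<close> and under reflection, integrating it
  over \<open>y\<close> returns \<open>G\<close>. No determinant enters, so the argument works in every
  Euclidean space, in particular in a product of two.
\<close>
lemma nn_integral_lborel_orthogonal:
  fixes T :: "'a::euclidean_space \<Rightarrow> 'a" and F :: "'a \<Rightarrow> ennreal"
  assumes T: "orthogonal_transformation T" and F[measurable]: "F \<in> borel_measurable borel"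
  shows "(\<integral>\<^sup>+y. F (T y) \<partial>lborel) = (\<integral>\<^sup>+y. F y \<partial>lborel)"
proof -
  define B where "B = (indicator (ball 0 1) :: 'a \<Rightarrow> ennreal)"
  have [measurable]: "B \<in> borel_measurable borel"
    unfolding B_def by (intro borel_measurable_indicator) simp
  define G where "G = (\<integral>\<^sup>+x. B x \<partial>lborel)"
  have "G = emeasure lborel (ball (0::'a) 1)"
    by (simp add: G_def B_def)
  moreover have "emeasure lborel (ball (0::'a) 1) < \<infinity>"
    by (rule emeasure_lborel_ball_finite)
  moreover have "emeasure lborel (ball (0::'a) 1) > 0"
    by (simp add: emeasure_ball content_ball_pos unit_ball_vol_pos)
  ultimately have G: "G \<noteq> 0" "G \<noteq> \<infinity>" by auto
  have lin: "linear T" and nrm: "\<And>x. norm (T x) = norm x"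
    using T by (auto simp: orthogonal_transformation)
  have Tm[measurable]: "T \<in> borel_measurable borel"
    using lin by (intro borel_measurable_continuous_onI linear_continuous_on)
      (simp add: linear_conv_bounded_linear)
  obtain S where S: "\<And>x. T (S x) = x"
    using orthogonal_transformation_surj[OF T] by (metis surjD)
  have ball: "B (x - T y) = B (S x + (- 1) *\<^sub>R y)" for x y
  proof -
    have "x - T y = T (S x - y)"
      by (simp add: linear_diff[OF lin] S)
    then show ?thesis
      by (simp add: B_def indicator_def nrm)
  qed
  have shift: "(\<integral>\<^sup>+y. F (x + T y) \<partial>lborel) = (\<integral>\<^sup>+y. F (T y) \<partial>lborel)" for x
  proof -
    have "(\<integral>\<^sup>+y. F (T y) \<partial>lborel) = (\<integral>\<^sup>+y. F (T (S x + 1 *\<^sub>R y)) \<partial>lborel)"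
      by (subst nn_integral_lborel_affine[where c=1 and t="S x"]) auto
    then show ?thesis
      by (simp add: linear_add[OF lin] S)
  qed
  have "G * (\<integral>\<^sup>+y. F (T y) \<partial>lborel) = (\<integral>\<^sup>+x. B x * (\<integral>\<^sup>+y. F (T y) \<partial>lborel) \<partial>lborel)"
    by (simp add: G_def nn_integral_multc)
  also have "\<dots> = (\<integral>\<^sup>+x. B x * (\<integral>\<^sup>+y. F (x + T y) \<partial>lborel) \<partial>lborel)"
    by (rule nn_integral_cong) (simp only: shift)
  also have "\<dots> = (\<integral>\<^sup>+x. \<integral>\<^sup>+y. B x * F (x + T y) \<partial>lborel \<partial>lborel)"
    by (simp add: nn_integral_cmult)
  also have "\<dots> = (\<integral>\<^sup>+y. \<integral>\<^sup>+x. B x * F (x + T y) \<partial>lborel \<partial>lborel)"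
    by (intro lborel_pair.Fubini'[symmetric]) measurable
  also have "\<dots> = (\<integral>\<^sup>+y. \<integral>\<^sup>+x. B (x - T y) * F x \<partial>lborel \<partial>lborel)"
  proof (rule nn_integral_cong)
    fix y :: 'a
    show "(\<integral>\<^sup>+x. B x * F (x + T y) \<partial>lborel) = (\<integral>\<^sup>+x. B (x - T y) * F x \<partial>lborel)"
      by (subst nn_integral_lborel_affine[where c=1 and t="- T y"]) auto
  qed
  also have "\<dots> = (\<integral>\<^sup>+x. \<integral>\<^sup>+y. B (x - T y) * F x \<partial>lborel \<partial>lborel)"
    by (intro lborel_pair.Fubini') measurable
  also have "\<dots> = (\<integral>\<^sup>+x. G * F x \<partial>lborel)"
  proof (rule nn_integral_cong)
    fix x :: 'a
    have "(\<integral>\<^sup>+y. B (x - T y) * F x \<partial>lborel) = (\<integral>\<^sup>+y. B (S x + (- 1) *\<^sub>R y) \<partial>lborel) * F x"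
      by (subst nn_integral_multc[symmetric]) (simp_all only: ball, simp_all)
    also have "(\<integral>\<^sup>+y. B (S x + (- 1) *\<^sub>R y) \<partial>lborel) = G"
      unfolding G_def by (subst (2) nn_integral_lborel_affine[where c="-1" and t="S x"]) auto
    finally show "(\<integral>\<^sup>+y. B (x - T y) * F x \<partial>lborel) = G * F x" .
  qed
  also have "\<dots> = G * (\<integral>\<^sup>+x. F x \<partial>lborel)"
    by (simp add: nn_integral_cmult)
  finally show ?thesis
    using G by (simp add: ennreal_mult_cancel_left)
qed

section \<open>Moments of the Cauchy weight\<close>

lemma nn_integral_gamma:
  fixes a s :: real
  assumes a: "a > 0" and s: "s > 0"
  shows "(\<integral>\<^sup>+t. ennreal (t powr (a - 1) * exp (- (s * t))) * indicator {0<..} t \<partial>lborel)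
    = ennreal (Gamma a * s powr (- a))"
proof -
  have "ennreal (Gamma a) = (\<integral>\<^sup>+t. ennreal (indicator {0..} t * t powr (a - 1) / exp t) \<partial>lborel)"
    by (rule Gamma_conv_nn_integral_real[OF a])
  also have "\<dots> = (\<integral>\<^sup>+t. ennreal (t powr (a - 1) * exp (- t)) * indicator {0<..} t \<partial>lborel)"
    by (intro nn_integral_cong_AE AE_I'[of "{0}"])
      (auto simp: indicator_def exp_minus field_simps split: if_splits)
  also have "\<dots> = ennreal \<bar>s\<bar> * (\<integral>\<^sup>+t. ennreal ((0 + s * t) powr (a - 1) * exp (- (0 + s * t)))
      * indicator {0<..} (0 + s * t) \<partial>lborel)"
    using s by (intro nn_integral_real_affine) auto
  also have "\<dots> = (\<integral>\<^sup>+t. ennreal (s powr a) * (ennreal (t powr (a - 1) * exp (- (s * t)))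
      * indicator {0<..} t) \<partial>lborel)"
    using s by (subst nn_integral_cmult[symmetric])
      (auto simp: indicator_def zero_less_mult_iff powr_mult powr_diff ennreal_mult'[symmetric]
        field_simps intro!: nn_integral_cong)
  also have "\<dots> = ennreal (s powr a) * (\<integral>\<^sup>+t. ennreal (t powr (a - 1) * exp (- (s * t)))
      * indicator {0<..} t \<partial>lborel)"
    by (rule nn_integral_cmult) measurable
  finally have *: "ennreal (Gamma a) = ennreal (s powr a) * (\<integral>\<^sup>+t. ennreal (t powr (a - 1) * exp (- (s * t)))
      * indicator {0<..} t \<partial>lborel)" .
  have "ennreal (s powr (- a)) * ennreal (Gamma a) = (\<integral>\<^sup>+t. ennreal (t powr (a - 1) * exp (- (s * t)))
      * indicator {0<..} t \<partial>lborel)"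
    using s unfolding * by (subst mult.assoc[symmetric], subst ennreal_mult'[symmetric])
      (auto simp: powr_add[symmetric])
  then show ?thesis
    using Gamma_real_pos[OF a] by (simp add: ennreal_mult' mult.commute)
qed

text \<open>By symmetry the integral is twice that over the positive half line, where the substitution
  \<open>u = z\<^sup>2\<close> turns it into a Gamma integral.\<close>
lemma nn_integral_gaussian_moment:
  fixes q s :: real
  assumes q: "q \<ge> 0" and s: "s > 0"
  shows "(\<integral>\<^sup>+z. ennreal (\<bar>z\<bar> powr q * exp (- (s * z\<^sup>2))) \<partial>lborel)
    = ennreal (Gamma ((q + 1) / 2) * s powr (- ((q + 1) / 2)))"
proof -
  define a where "a = (q + 1) / 2"
  have a: "a > 0" using q by (simp add: a_def)
  let ?f = "\<lambda>u::real. u powr (a - 1) * exp (- (s * u))"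
  let ?h = "\<lambda>z::real. ennreal (\<bar>z\<bar> powr q * exp (- (s * z\<^sup>2)))"
  have reflect: "(\<integral>\<^sup>+z. ?h z * indicator {0<..} z \<partial>lborel) = (\<integral>\<^sup>+z. ?h z * indicator {..<0} z \<partial>lborel)"
  proof -
    have "(\<integral>\<^sup>+z. ?h z * indicator {0<..} z \<partial>lborel)
        = ennreal \<bar>- 1\<bar> * (\<integral>\<^sup>+z. ?h (0 + (- 1) * z) * indicator {0<..} (0 + (- 1) * z) \<partial>lborel)"
      by (rule nn_integral_real_affine) auto
    also have "\<dots> = (\<integral>\<^sup>+z. ?h z * indicator {..<0} z \<partial>lborel)"
      by (simp add: indicator_def)
    finally show ?thesis .
  qed
  have halves: "(\<integral>\<^sup>+z. ?h z * indicator {0<..} z \<partial>lborel) + (\<integral>\<^sup>+z. ?h z * indicator {0<..} z \<partial>lborel)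
      = (\<integral>\<^sup>+z. ?h z \<partial>lborel)"
  proof -
    have "(\<integral>\<^sup>+z. ?h z \<partial>lborel)
       = (\<integral>\<^sup>+z. ?h z * indicator {0<..} z + ?h z * indicator {..<0} z \<partial>lborel)"
      by (intro nn_integral_cong_AE AE_I'[of "{0}"]) (auto simp: indicator_def)
    also have "\<dots> = (\<integral>\<^sup>+z. ?h z * indicator {0<..} z \<partial>lborel) + (\<integral>\<^sup>+z. ?h z * indicator {..<0} z \<partial>lborel)"
      by (rule nn_integral_add) auto
    finally show ?thesis by (simp only: reflect)
  qed
  define I where "I = Gamma a * s powr (- a)"
  have I0: "I \<ge> 0" unfolding I_def using Gamma_real_pos[OF a] by auto
  have "((\<lambda>u. ?f u * indicator {0<..} u) has_integral I) UNIV"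
    using nn_integral_gamma[OF a s] I0 unfolding I_def
    by (intro nn_integral_has_integral)
      (auto simp: ennreal_mult'' ennreal_indicator)
  then have "(?f has_integral I) {0<..}"
    by (subst has_integral_restrict_UNIV[symmetric]) (simp add: indicator_def of_bool_def if_distrib cong: if_cong)
  then have abs: "?f absolutely_integrable_on {0<..} \<and> integral {0<..} ?f = I"
    by (auto intro!: nonnegative_absolutely_integrable_1 simp: integrable_on_def integral_unique)
  have img: "(\<lambda>z::real. z\<^sup>2) ` {0<..} = {0<..}"
  proof (intro equalityI subsetI)
    fix x :: real assume "x \<in> {0<..}"
    then show "x \<in> (\<lambda>z. z\<^sup>2) ` {0<..}"
      by (intro image_eqI[where x="sqrt x"]) auto
  qed auto
  have "(\<lambda>z. \<bar>2 * z\<bar> * ?f (z\<^sup>2)) absolutely_integrable_on {0<..} \<and>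
      integral {0<..} (\<lambda>z. \<bar>2 * z\<bar> * ?f (z\<^sup>2)) = I"
    using abs
    by (subst has_absolute_integral_change_of_variables_1'[where g="\<lambda>z. z\<^sup>2" and g'="\<lambda>z. 2 * z"])
      (auto simp: img intro!: derivative_eq_intros inj_onI)
  then have "((\<lambda>z. \<bar>2 * z\<bar> * ?f (z\<^sup>2)) has_integral I) {0<..}"
    by (simp add: has_integral_integrable_integral set_lebesgue_integral_eq_integral(1))
  then have "ennreal I = (\<integral>\<^sup>+z. ennreal (\<bar>2 * z\<bar> * ?f (z\<^sup>2)) * indicator {0<..} z \<partial>lborel)"
    by (intro nn_integral_has_integral_lebesgue'[symmetric]) auto
  also have "\<dots> = (\<integral>\<^sup>+z. 2 * (?h z * indicator {0<..} z) \<partial>lborel)"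
  proof (rule nn_integral_cong)
    fix z :: real
    have "2 * z * (z\<^sup>2) powr (a - 1) = 2 * z powr q" if "z > 0"
    proof -
      have "(z\<^sup>2) powr (a - 1) = (z powr 2) powr (a - 1)"
        using that by simp
      also have "\<dots> = z powr (q - 1)"
        unfolding powr_powr by (rule arg_cong[where f="(powr) z"]) (simp add: a_def field_simps)
      finally have "(z\<^sup>2) powr (a - 1) = z powr (q - 1)" .
      moreover have "z powr q = z powr 1 * z powr (q - 1)"
        by (metis add.commute diff_add_cancel powr_add)
      ultimately show ?thesis
        using that by simp
    qed
    then have double: "\<bar>2 * z\<bar> * ?f (z\<^sup>2) = 2 * (\<bar>z\<bar> powr q * exp (- (s * z\<^sup>2)))" if "z > 0"
      using that by (simp flip: mult.assoc)
    show "ennreal (\<bar>2 * z\<bar> * ?f (z\<^sup>2)) * indicator {0<..} z = 2 * (?h z * indicator {0<..} z)"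
    proof (cases "z > 0")
      case True
      have "ennreal (\<bar>2 * z\<bar> * ?f (z\<^sup>2)) = ennreal 2 * ?h z"
        unfolding double[OF True] by (rule ennreal_mult') simp
      with True show ?thesis by simp
    qed simp
  qed
  also have "\<dots> = (\<integral>\<^sup>+z. ?h z * indicator {0<..} z \<partial>lborel) + (\<integral>\<^sup>+z. ?h z * indicator {0<..} z \<partial>lborel)"
    by (subst nn_integral_cmult) (auto simp: mult_2)
  also have "\<dots> = (\<integral>\<^sup>+z. ?h z \<partial>lborel)"
    by (rule halves)
  finally show ?thesis by (simp add: I_def a_def)
qed

text \<open>The moment of order \<open>0\<close>; since \<open>0 powr 0 = 0\<close>, the integrands differ at the origin.\<close>
lemma nn_integral_gaussian:
  fixes s :: real
  assumes s: "s > 0"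
  shows "(\<integral>\<^sup>+z. ennreal (exp (- (s * z\<^sup>2))) \<partial>lborel) = ennreal (sqrt pi * s powr (- (1 / 2)))"
proof -
  have "(\<integral>\<^sup>+z. ennreal (exp (- (s * z\<^sup>2))) \<partial>lborel)
      = (\<integral>\<^sup>+z. ennreal (\<bar>z\<bar> powr 0 * exp (- (s * z\<^sup>2))) \<partial>lborel)"
    by (intro nn_integral_cong_AE AE_I'[of "{0}"]) auto
  then show ?thesis
    using nn_integral_gaussian_moment[of 0 s] s by (simp add: Gamma_one_half_real)
qed

text \<open>
  By the Gamma integral, \<open>Gamma \<alpha> * (1 + \<bar>z\<bar>\<^sup>2) powr (- \<alpha>)\<close> is the integral of
  \<open>s powr (\<alpha> - 1) * exp (- s) * exp (- s * \<bar>z\<bar>\<^sup>2)\<close> over \<open>s > 0\<close>. After exchanging the integrals, the one over \<open>z\<close>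
  is Gaussian and factors over the coordinates; its value is a multiple of a power of \<open>s\<close>, so
  that the remaining integral over \<open>s\<close> is again a Gamma integral.
\<close>
lemma nn_integral_cauchy_weight_moment:
  fixes b :: "'a::euclidean_space" and p \<alpha> :: real
  assumes b: "b \<in> Basis" and p: "p \<ge> 0" and \<alpha>: "\<alpha> > (real DIM('a) + p) / 2"
  shows "(\<integral>\<^sup>+z. ennreal (\<bar>z \<bullet> b\<bar> powr p * (1 + (norm z)\<^sup>2) powr (- \<alpha>)) \<partial>lborel)
    = ennreal (pi powr ((real DIM('a) - 1) / 2) * Gamma ((p + 1) / 2)
        * Gamma (\<alpha> - (real DIM('a) + p) / 2) / Gamma \<alpha>)"
proof -
  define n where "n = DIM('a)"
  have n: "n \<ge> 1" by (simp add: n_def Suc_leI)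
  define \<gamma> where "\<gamma> = \<alpha> - (real n + p) / 2"
  have \<gamma>: "\<gamma> > 0" and \<alpha>0: "\<alpha> > 0"
    using \<alpha> p by (auto simp: \<gamma>_def n_def field_simps)
  have pos: "Gamma \<alpha> > 0" "Gamma \<gamma> > 0" "Gamma ((p + 1) / 2) > 0"
    using \<alpha>0 \<gamma> p by (auto intro!: Gamma_real_pos)
  define K where "K = Gamma ((p + 1) / 2) * sqrt pi ^ (n - 1)"
  have K: "K \<ge> 0" using pos by (simp add: K_def)
  \<comment> \<open>one-dimensional factors: only the coordinate along \<open>b\<close> carries the power\<close>
  define g where "g = (\<lambda>s c t. ennreal ((if c = b then \<bar>t\<bar> powr p else 1) * exp (- (s * t\<^sup>2))))"
  have gm[measurable]: "g s c \<in> borel_measurable borel" for s :: real and c :: 'a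
    unfolding g_def by measurable
  have g_prod: "(\<Prod>c\<in>Basis. g s c (z \<bullet> c)) = ennreal (\<bar>z \<bullet> b\<bar> powr p * exp (- (s * (norm z)\<^sup>2)))"
    for s :: real and z :: 'a
  proof -
    have "(\<Prod>c\<in>Basis. g s c (z \<bullet> c))
        = ennreal ((\<Prod>c\<in>Basis. if c = b then \<bar>z \<bullet> c\<bar> powr p else 1) * exp (\<Sum>c\<in>Basis. - (s * (z \<bullet> c)\<^sup>2)))"
      by (simp add: g_def prod_ennreal prod.distrib exp_sum)
    also have "(\<Prod>c\<in>Basis. if c = b then \<bar>z \<bullet> c\<bar> powr p else 1) = \<bar>z \<bullet> b\<bar> powr p"
      using b by (subst prod.delta) auto
    also have "(\<Sum>c\<in>Basis. - (s * (z \<bullet> c)\<^sup>2)) = - (s * (norm z)\<^sup>2)"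
    proof -
      have "(norm z)\<^sup>2 = (\<Sum>c\<in>Basis. (z \<bullet> c)\<^sup>2)"
        by (simp add: power2_norm_eq_inner euclidean_inner[of z z] flip: power2_eq_square)
      then show ?thesis by (simp add: sum_negf sum_distrib_left)
    qed
    finally show ?thesis .
  qed
  have gauss: "(\<integral>\<^sup>+z. ennreal (\<bar>z \<bullet> b\<bar> powr p * exp (- (s * (norm z)\<^sup>2))) \<partial>lborel)
      = ennreal (K * s powr (- ((real n + p) / 2)))" if s: "s > 0" for s :: real
  proof -
    have "(\<integral>\<^sup>+z. ennreal (\<bar>z \<bullet> b\<bar> powr p * exp (- (s * (norm z)\<^sup>2))) \<partial>lborel)
        = (\<Prod>c\<in>Basis. \<integral>\<^sup>+t. g s c t \<partial>lborel)"
      unfolding g_prod[symmetric] by (rule nn_integral_lborel_prod) auto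
    also have "\<dots> = (\<integral>\<^sup>+t. g s b t \<partial>lborel) * (\<Prod>c\<in>Basis - {b}. \<integral>\<^sup>+t. g s c t \<partial>lborel)"
      by (rule prod.remove) (use b in auto)
    also have "(\<integral>\<^sup>+t. g s b t \<partial>lborel) = ennreal (Gamma ((p + 1) / 2) * s powr (- ((p + 1) / 2)))"
      using nn_integral_gaussian_moment[OF p s] by (simp add: g_def)
    also have "(\<Prod>c\<in>Basis - {b}. \<integral>\<^sup>+t. g s c t \<partial>lborel)
        = (\<Prod>c\<in>Basis - {b}. ennreal (sqrt pi * s powr (- (1 / 2))))"
      using nn_integral_gaussian[OF s] by (intro prod.cong) (auto simp: g_def)
    also have "\<dots> = ennreal ((sqrt pi * s powr (- (1 / 2))) ^ (n - 1))"
      using b by (simp add: n_def ennreal_power)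
    also have "ennreal (Gamma ((p + 1) / 2) * s powr (- ((p + 1) / 2))) * \<dots>
        = ennreal (Gamma ((p + 1) / 2) * s powr (- ((p + 1) / 2)) * (sqrt pi * s powr (- (1 / 2))) ^ (n - 1))"
      using pos by (intro ennreal_mult'[symmetric]) auto
    also have "Gamma ((p + 1) / 2) * s powr (- ((p + 1) / 2)) * (sqrt pi * s powr (- (1 / 2))) ^ (n - 1)
        = K * (s powr (- ((p + 1) / 2)) * s powr (- (real (n - 1) / 2)))"
      using s by (simp add: K_def power_mult_distrib powr_power mult_ac)
    also have "s powr (- ((p + 1) / 2)) * s powr (- (real (n - 1) / 2)) = s powr (- ((real n + p) / 2))"
      unfolding powr_add[symmetric]
      by (rule arg_cong[where f="(powr) s"]) (use n in \<open>simp add: of_nat_diff field_simps\<close>)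
    finally show ?thesis .
  qed
  have "ennreal (Gamma \<alpha>) * (\<integral>\<^sup>+z. ennreal (\<bar>z \<bullet> b\<bar> powr p * (1 + (norm z)\<^sup>2) powr (- \<alpha>)) \<partial>lborel)
      = (\<integral>\<^sup>+z. ennreal (\<bar>z \<bullet> b\<bar> powr p) * ennreal (Gamma \<alpha> * (1 + (norm z)\<^sup>2) powr (- \<alpha>)) \<partial>lborel)"
    using pos by (subst nn_integral_cmult[symmetric])
      (auto simp: ennreal_mult'[symmetric] mult_ac intro!: nn_integral_cong)
  also have "\<dots> = (\<integral>\<^sup>+z. ennreal (\<bar>z \<bullet> b\<bar> powr p) * (\<integral>\<^sup>+s. ennreal (s powr (\<alpha> - 1) *
      exp (- ((1 + (norm z)\<^sup>2) * s))) * indicator {0<..} s \<partial>lborel) \<partial>lborel)"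
    using \<alpha>0 by (subst nn_integral_gamma) (auto simp: add_pos_nonneg)
  also have "\<dots> = (\<integral>\<^sup>+z. \<integral>\<^sup>+s. ennreal (\<bar>z \<bullet> b\<bar> powr p) * (ennreal (s powr (\<alpha> - 1) *
      exp (- ((1 + (norm z)\<^sup>2) * s))) * indicator {0<..} s) \<partial>lborel \<partial>lborel)"
    by (subst nn_integral_cmult) auto
  also have "\<dots> = (\<integral>\<^sup>+s. \<integral>\<^sup>+z. ennreal (\<bar>z \<bullet> b\<bar> powr p) * (ennreal (s powr (\<alpha> - 1) *
      exp (- ((1 + (norm z)\<^sup>2) * s))) * indicator {0<..} s) \<partial>lborel \<partial>lborel)"
    by (intro lborel_pair.Fubini') measurable
  also have "\<dots> = (\<integral>\<^sup>+s. ennreal K * (ennreal (s powr (\<gamma> - 1) * exp (- (1 * s))) * indicator {0<..} s) \<partial>lborel)"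
  proof (rule nn_integral_cong)
    fix s :: real
    show "(\<integral>\<^sup>+z. ennreal (\<bar>z \<bullet> b\<bar> powr p) * (ennreal (s powr (\<alpha> - 1) *
        exp (- ((1 + (norm z)\<^sup>2) * s))) * indicator {0<..} s) \<partial>lborel)
      = ennreal K * (ennreal (s powr (\<gamma> - 1) * exp (- (1 * s))) * indicator {0<..} s)"
    proof (cases "s > 0")
      case True
      have "(\<integral>\<^sup>+z. ennreal (\<bar>z \<bullet> b\<bar> powr p) * (ennreal (s powr (\<alpha> - 1) *
          exp (- ((1 + (norm z)\<^sup>2) * s))) * indicator {0<..} s) \<partial>lborel)
        = (\<integral>\<^sup>+z. ennreal (s powr (\<alpha> - 1) * exp (- s))
            * ennreal (\<bar>z \<bullet> b\<bar> powr p * exp (- (s * (norm z)\<^sup>2))) \<partial>lborel)"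
        using True
        by (intro nn_integral_cong)
          (simp add: ennreal_mult'[symmetric] algebra_simps exp_add[symmetric] exp_diff[symmetric])
      also have "\<dots> = ennreal (s powr (\<alpha> - 1) * exp (- s)) * ennreal (K * s powr (- ((real n + p) / 2)))"
        by (subst nn_integral_cmult) (auto simp: gauss[OF True])
      also have "\<dots> = ennreal (K * (s powr (\<alpha> - 1) * s powr (- ((real n + p) / 2)) * exp (- s)))"
        by (subst ennreal_mult'[symmetric]) (auto simp: mult_ac)
      also have "s powr (\<alpha> - 1) * s powr (- ((real n + p) / 2)) = s powr (\<gamma> - 1)"
        by (simp add: powr_add[symmetric] \<gamma>_def algebra_simps)
      finally show ?thesis
        using True K by (simp add: ennreal_mult')
    qed auto
  qed
  also have "\<dots> = ennreal K * ennreal (Gamma \<gamma> * 1 powr (- \<gamma>))"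
    by (subst nn_integral_cmult, simp, subst nn_integral_gamma) (use \<gamma> in auto)
  finally have *: "ennreal (Gamma \<alpha>) *
      (\<integral>\<^sup>+z. ennreal (\<bar>z \<bullet> b\<bar> powr p * (1 + (norm z)\<^sup>2) powr (- \<alpha>)) \<partial>lborel)
      = ennreal (K * Gamma \<gamma>)"
    using K by (simp add: ennreal_mult')
  have "sqrt pi ^ (n - 1) = pi powr ((real n - 1) / 2)"
    using n by (simp add: powr_half_sqrt[symmetric] powr_power of_nat_diff)
  then have "pi powr ((real n - 1) / 2) * Gamma ((p + 1) / 2) * Gamma \<gamma> / Gamma \<alpha> = inverse (Gamma \<alpha>) * (K * Gamma \<gamma>)"
    by (simp add: K_def field_simps)
  moreover have "(\<integral>\<^sup>+z. ennreal (\<bar>z \<bullet> b\<bar> powr p * (1 + (norm z)\<^sup>2) powr (- \<alpha>)) \<partial>lborel)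
      = ennreal (inverse (Gamma \<alpha>)) * ennreal (K * Gamma \<gamma>)"
    unfolding *[symmetric] using pos
    by (subst mult.assoc[symmetric], subst ennreal_mult'[symmetric]) auto
  ultimately show ?thesis
    using pos by (simp add: n_def \<gamma>_def ennreal_mult')
qed

text \<open>The weight is radial, so \<open>v\<close> may be rotated onto a coordinate axis.\<close>
lemma nn_integral_cauchy_weight_inner:
  fixes v :: "real ^ 'n" and p \<alpha> :: real
  assumes p: "p > 0" and \<alpha>: "\<alpha> > (real CARD('n) + p) / 2"
  shows "(\<integral>\<^sup>+z. ennreal (\<bar>v \<bullet> z\<bar> powr p * (1 + (norm z)\<^sup>2) powr (- \<alpha>)) \<partial>lborel)
    = ennreal (norm v powr p) * ennreal (pi powr ((real CARD('n) - 1) / 2) * Gamma ((p + 1) / 2)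
        * Gamma (\<alpha> - (real CARD('n) + p) / 2) / Gamma \<alpha>)"
proof -
  obtain b :: "real ^ 'n" where b: "b \<in> Basis" by (meson nonempty_Basis all_not_in_conv)
  have "norm (norm v *\<^sub>R b) = norm v" using b by simp
  then obtain T where T: "orthogonal_transformation T" "T (norm v *\<^sub>R b) = v"
    by (rule orthogonal_transformation_exists)
  have *: "v \<bullet> T z = norm v * (z \<bullet> b)" for z
    using T by (metis (no_types) orthogonal_transformation_def inner_scaleR_left inner_commute)
  have "(\<integral>\<^sup>+z. ennreal (\<bar>v \<bullet> z\<bar> powr p * (1 + (norm z)\<^sup>2) powr (- \<alpha>)) \<partial>lborel)
     = (\<integral>\<^sup>+z. ennreal (\<bar>v \<bullet> T z\<bar> powr p * (1 + (norm (T z))\<^sup>2) powr (- \<alpha>)) \<partial>lborel)"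
    by (rule nn_integral_lborel_orthogonal[symmetric, OF T(1)]) measurable
  also have "\<dots> = (\<integral>\<^sup>+z. ennreal (norm v powr p) * ennreal (\<bar>z \<bullet> b\<bar> powr p * (1 + (norm z)\<^sup>2) powr (- \<alpha>)) \<partial>lborel)"
    by (simp add: * orthogonal_transformation_norm[OF T(1)] abs_mult powr_mult ennreal_mult'[symmetric] mult_ac)
  also have "\<dots> = ennreal (norm v powr p) * (\<integral>\<^sup>+z. ennreal (\<bar>z \<bullet> b\<bar> powr p * (1 + (norm z)\<^sup>2) powr (- \<alpha>)) \<partial>lborel)"
    by (rule nn_integral_cmult) measurable
  finally show ?thesis
    using nn_integral_cauchy_weight_moment[OF b, of p \<alpha>] p \<alpha> by simp
qed

text \<open>
  With \<open>u = 1 + \<bar>x\<bar>\<^sup>2\<close> this is the integral over the slice of the \<open>2n\<close>-dimensional weight at \<open>x\<close>. The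
  dilation \<open>y = sqrt u *\<^sub>R z\<close> gives the factors \<open>u powr (n / 2)\<close> (volume), \<open>u powr (p / 2)\<close> (the
  linear form) and \<open>u powr (- \<alpha>)\<close> (the weight). This is what fixes the order
  \<open>\<beta> = \<alpha> - (n + p) / 2\<close> of the measure on the right of the inequality.
\<close>
lemma nn_integral_cauchy_slice:
  fixes v :: "real ^ 'n" and p \<alpha> u :: real
  assumes p: "p > 0" and \<alpha>: "\<alpha> > (real CARD('n) + p) / 2" and u: "u > 0"
  shows "(\<integral>\<^sup>+y. ennreal (\<bar>v \<bullet> y\<bar> powr p * (u + (norm y)\<^sup>2) powr (- \<alpha>)) \<partial>lborel)
    = ennreal (norm v powr p * u powr (- (\<alpha> - (real CARD('n) + p) / 2)))
      * ennreal (pi powr ((real CARD('n) - 1) / 2) * Gamma ((p + 1) / 2)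
        * Gamma (\<alpha> - (real CARD('n) + p) / 2) / Gamma \<alpha>)" (is "?lhs = _ * ?K")
proof -
  have pt: "sqrt u ^ CARD('n) * (\<bar>v \<bullet> (sqrt u *\<^sub>R z)\<bar> powr p * (u + (norm (sqrt u *\<^sub>R z))\<^sup>2) powr (- \<alpha>))
     = u powr (- (\<alpha> - (real CARD('n) + p) / 2)) * (\<bar>v \<bullet> z\<bar> powr p * (1 + (norm z)\<^sup>2) powr (- \<alpha>))"
    for z :: "real ^ 'n"
  proof -
    have "u + (norm (sqrt u *\<^sub>R z))\<^sup>2 = u * (1 + (norm z)\<^sup>2)"
      using u by (simp add: power_mult_distrib algebra_simps)
    moreover have "\<bar>v \<bullet> (sqrt u *\<^sub>R z)\<bar> powr p = u powr (p / 2) * \<bar>v \<bullet> z\<bar> powr p"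
      using u by (simp add: abs_mult powr_mult powr_powr flip: powr_half_sqrt)
    moreover have "sqrt u ^ CARD('n) = u powr (real CARD('n) / 2)"
      using u by (simp add: powr_power flip: powr_half_sqrt)
    moreover have "u powr (- (\<alpha> - (real CARD('n) + p) / 2))
        = u powr (real CARD('n) / 2) * u powr (p / 2) * u powr (- \<alpha>)"
      unfolding powr_add[symmetric]
      by (rule arg_cong[where f="(powr) u"]) (simp add: field_simps)
    ultimately show ?thesis
      using u by (simp add: powr_mult add_nonneg_nonneg mult_ac)
  qed
  have "?lhs = ennreal (\<bar>sqrt u\<bar> ^ DIM(real ^ 'n)) * (\<integral>\<^sup>+z. ennreal (\<bar>v \<bullet> (0 + sqrt u *\<^sub>R z)\<bar> powr p
      * (u + (norm (0 + sqrt u *\<^sub>R z))\<^sup>2) powr (- \<alpha>)) \<partial>lborel)"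
    using u by (intro nn_integral_lborel_affine) auto
  also have "\<dots> = (\<integral>\<^sup>+z. ennreal (sqrt u ^ CARD('n) * (\<bar>v \<bullet> (sqrt u *\<^sub>R z)\<bar> powr p
      * (u + (norm (sqrt u *\<^sub>R z))\<^sup>2) powr (- \<alpha>))) \<partial>lborel)"
    using u by (subst nn_integral_cmult[symmetric]) (auto simp: ennreal_mult')
  also have "\<dots> = (\<integral>\<^sup>+z. ennreal (u powr (- (\<alpha> - (real CARD('n) + p) / 2)))
      * ennreal (\<bar>v \<bullet> z\<bar> powr p * (1 + (norm z)\<^sup>2) powr (- \<alpha>)) \<partial>lborel)"
    unfolding pt by (simp add: ennreal_mult')
  also have "\<dots> = ennreal (u powr (- (\<alpha> - (real CARD('n) + p) / 2)))
      * (\<integral>\<^sup>+z. ennreal (\<bar>v \<bullet> z\<bar> powr p * (1 + (norm z)\<^sup>2) powr (- \<alpha>)) \<partial>lborel)"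
    by (rule nn_integral_cmult) measurable
  also have "\<dots> = ennreal (u powr (- (\<alpha> - (real CARD('n) + p) / 2))) * (ennreal (norm v powr p) * ?K)"
    by (subst nn_integral_cauchy_weight_inner[OF p \<alpha>]) simp
  also have "\<dots> = ennreal (norm v powr p * u powr (- (\<alpha> - (real CARD('n) + p) / 2))) * ?K"
    by (simp add: ennreal_mult' mult_ac)
  finally show ?thesis .
qed

section \<open>Differences along a rotation\<close>

text \<open>
  Jensen's inequality for \<open>t \<mapsto> t powr p\<close> on an interval. The tangent of this convex function at
  the mean \<open>m\<close> of \<open>\<bar>g\<bar>\<close> lies below it, and integrating the tangent evaluated at \<open>\<bar>g t\<bar>\<close> gives
  exactly \<open>(b - a) * m powr p\<close>.
\<close>
lemma powr_integral_le:
  fixes g :: "real \<Rightarrow> real" and a b p :: real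
  assumes ab: "a < b" and p: "p \<ge> 1" and g: "continuous_on {a..b} g"
  shows "\<bar>integral {a..b} g\<bar> powr p \<le> (b - a) powr (p - 1) * integral {a..b} (\<lambda>t. \<bar>g t\<bar> powr p)"
proof -
  define I where "I = integral {a..b} (\<lambda>t. \<bar>g t\<bar>)"
  define m where "m = I / (b - a)"
  have int1: "(\<lambda>t. \<bar>g t\<bar>) integrable_on {a..b}"
    by (intro integrable_continuous_real continuous_intros g)
  have intp: "(\<lambda>t. \<bar>g t\<bar> powr p) integrable_on {a..b}"
    using p by (intro integrable_continuous_real continuous_on_powr' continuous_intros g) auto
  have le: "\<bar>integral {a..b} g\<bar> \<le> I"
    using integral_norm_bound_integral[OF integrable_continuous_real[OF g] int1] by (simp add: I_def)
  have powr_ge0: "integral {a..b} (\<lambda>t. \<bar>g t\<bar> powr p) \<ge> 0"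
    by (rule integral_nonneg[OF intp]) auto
  have "I powr p \<le> (b - a) powr (p - 1) * integral {a..b} (\<lambda>t. \<bar>g t\<bar> powr p)"
  proof (cases "I > 0")
    case True
    then have m: "m > 0" using ab by (simp add: m_def)
    have tangent: "m powr p + p * m powr (p - 1) * (t - m) \<le> t powr p" if t: "t \<ge> 0" for t
    proof (cases "t = 0")
      case True
      have "m powr p = m powr (p - 1) * m"
        using m by (simp add: powr_diff)
      then have "m powr p + p * m powr (p - 1) * (t - m) = (1 - p) * m powr p"
        using True by (simp add: algebra_simps)
      also have "\<dots> \<le> 0"
        using p by (intro mult_nonpos_nonneg) auto
      finally show ?thesis using True by simp
    next
      case False
      have "p * m powr (p - 1) * (t - m) \<le> t powr p - m powr p"
        using t False m p
        by (intro convex_on_imp_above_tangent[where A="{0<..}"] powr_convex)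
          (auto simp: interior_open intro!: derivative_eq_intros)
      then show ?thesis by simp
    qed
    have "(b - a) * m powr p = integral {a..b} (\<lambda>t. m powr p + p * m powr (p - 1) * (\<bar>g t\<bar> - m))"
    proof -
      have "((\<lambda>t. m powr p + p * m powr (p - 1) * (\<bar>g t\<bar> - m)) has_integral
          (b - a) *\<^sub>R m powr p + p * m powr (p - 1) * (I - (b - a) *\<^sub>R m)) {a..b}"
        unfolding I_def using ab int1
        by (intro has_integral_add has_integral_mult_right has_integral_diff integrable_integral
            has_integral_const_real[where a=a and b=b, THEN has_integral_eq_rhs]) auto
      then show ?thesis using ab by (simp add: m_def integral_unique)
    qed
    also have "\<dots> \<le> integral {a..b} (\<lambda>t. \<bar>g t\<bar> powr p)"
      using int1 intp tangent
      by (intro integral_le integrable_add integrable_on_mult_right integrable_diff) auto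
    finally have "(b - a) powr (p - 1) * ((b - a) * m powr p)
        \<le> (b - a) powr (p - 1) * integral {a..b} (\<lambda>t. \<bar>g t\<bar> powr p)"
      by (intro mult_left_mono) auto
    also have "(b - a) powr (p - 1) * ((b - a) * m powr p) = I powr p"
      using ab True by (simp add: m_def powr_divide powr_diff)
    finally show ?thesis .
  next
    case False
    then have "I = 0" using le by linarith
    then show ?thesis using powr_ge0 by simp
  qed
  moreover have "\<bar>integral {a..b} g\<bar> powr p \<le> I powr p"
    using p le by (intro powr_mono2) auto
  ultimately show ?thesis by linarith
qed

lemma smooth_imp_continuous_gradient:
  fixes f :: "real ^ 'n \<Rightarrow> real"
  assumes "smooth f"
  shows "continuous_on UNIV (gradient f)"
proof -
  have "C_order (Suc 0) f" using assms by (simp add: smooth_def)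
  then have "continuous_on UNIV (\<lambda>x. frechet_derivative f (at x) v)" for v
    by simp
  then show ?thesis
    unfolding gradient_def by (intro continuous_on_vec_lambda)
qed

lemma smooth_imp_GDERIV:
  fixes f :: "real ^ 'n \<Rightarrow> real"
  assumes "smooth f"
  shows "GDERIV f x :> gradient f x"
proof -
  have "C_order (Suc 0) f" using assms by (simp add: smooth_def)
  then show ?thesis by (intro GDERIV_gradient) simp
qed

text \<open>
  The rotation by the angle \<open>\<theta>\<close> that mixes the two factors. The second component is the
  derivative in \<open>\<theta>\<close> of the first, and the first component runs from \<open>fst z\<close> to \<open>snd z\<close> for \<open>\<theta>\<close>
  from \<open>0\<close> to \<open>pi / 2\<close>.
\<close>
definition pair_rotation :: "real \<Rightarrow> 'a::real_vector \<times> 'a \<Rightarrow> 'a \<times> 'a"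
  where "pair_rotation \<theta> z = (cos \<theta> *\<^sub>R fst z + sin \<theta> *\<^sub>R snd z, cos \<theta> *\<^sub>R snd z - sin \<theta> *\<^sub>R fst z)"

lemma orthogonal_transformation_pair_rotation:
  "orthogonal_transformation (pair_rotation \<theta> :: 'a::euclidean_space \<times> 'a \<Rightarrow> 'a \<times> 'a)"
proof -
  have "linear (pair_rotation \<theta> :: 'a \<times> 'a \<Rightarrow> 'a \<times> 'a)"
    by (intro linearI) (auto simp: pair_rotation_def algebra_simps)
  moreover have "pair_rotation \<theta> v \<bullet> pair_rotation \<theta> w = v \<bullet> w" for v w :: "'a \<times> 'a"
  proof -
    have "pair_rotation \<theta> v \<bullet> pair_rotation \<theta> w = ((cos \<theta>)\<^sup>2 + (sin \<theta>)\<^sup>2) * (fst v \<bullet> fst w + snd v \<bullet> snd w)"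
      by (simp add: pair_rotation_def inner_prod_def algebra_simps power2_eq_square
          del: sin_cos_squared_add sin_cos_squared_add2 sin_cos_squared_add3)
    then show ?thesis by (simp add: inner_prod_def)
  qed
  ultimately show ?thesis by (simp add: orthogonal_transformation_def)
qed

lemma measurable_pair_rotation[measurable]:
  "(\<lambda>(\<theta>, z). pair_rotation \<theta> z :: 'a::euclidean_space \<times> 'a) \<in> borel_measurable (borel \<Otimes>\<^sub>M borel)"
proof -
  have "continuous_on UNIV (\<lambda>(\<theta>, z). pair_rotation \<theta> z :: 'a \<times> 'a)"
    unfolding pair_rotation_def case_prod_unfold by (intro continuous_intros)
  then have "(\<lambda>(\<theta>, z). pair_rotation \<theta> z :: 'a \<times> 'a) \<in> borel_measurable borel"
    by (rule borel_measurable_continuous_onI)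
  then show ?thesis
    by (simp add: borel_prod)
qed

text \<open>
  The fundamental theorem of calculus along the quarter circle from \<open>fst z\<close> to \<open>snd z\<close>, followed by
  Jensen's inequality. The integrand is one fixed function evaluated at the rotated point,
  so that averaging against a rotation-invariant weight removes the angle.
\<close>
lemma powr_diff_le_nn_integral_rotation:
  fixes f :: "real ^ 'n \<Rightarrow> real" and z :: "(real ^ 'n) \<times> (real ^ 'n)"
  assumes f: "smooth f" and p: "p \<ge> 1"
  shows "ennreal (\<bar>f (fst z) - f (snd z)\<bar> powr p) \<le> ennreal ((pi / 2) powr (p - 1)) *
    (\<integral>\<^sup>+\<theta>. ennreal (\<bar>gradient f (fst (pair_rotation \<theta> z)) \<bullet> snd (pair_rotation \<theta> z)\<bar> powr p) * indicator {0..pi / 2} \<theta> \<partial>lborel)"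
proof -
  define g where "g \<theta> = gradient f (fst (pair_rotation \<theta> z)) \<bullet> snd (pair_rotation \<theta> z)" for \<theta>
  have rotation_cont: "continuous_on S (\<lambda>\<theta>. pair_rotation \<theta> z)" for S
    unfolding pair_rotation_def by (intro continuous_intros)
  have "continuous_on {0..pi / 2} (\<lambda>\<theta>. gradient f (fst (pair_rotation \<theta> z)))"
    by (rule continuous_on_compose2[OF smooth_imp_continuous_gradient[OF f]])
      (auto intro!: continuous_intros rotation_cont)
  then have g: "continuous_on {0..pi / 2} g"
    unfolding g_def by (intro continuous_intros rotation_cont)
  have "((\<lambda>\<theta>. f (fst (pair_rotation \<theta> z))) has_vector_derivative g \<theta>) (at \<theta> within {0..pi / 2})" for \<theta>
  proof -
    have D: "((\<lambda>\<theta>. fst (pair_rotation \<theta> z)) has_derivative (\<lambda>t. t *\<^sub>R snd (pair_rotation \<theta> z))) (at \<theta> within {0..pi / 2})"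
      unfolding pair_rotation_def by (auto intro!: derivative_eq_intros simp: algebra_simps)
    have "(f has_derivative (\<lambda>h. h \<bullet> gradient f (fst (pair_rotation \<theta> z)))) (at (fst (pair_rotation \<theta> z)))"
      using smooth_imp_GDERIV[OF f] by (simp add: gderiv_def)
    from has_derivative_compose[OF D this] show ?thesis
      by (simp add: has_vector_derivative_def g_def inner_commute)
  qed
  then have "(g has_integral f (fst (pair_rotation (pi / 2) z)) - f (fst (pair_rotation 0 z))) {0..pi / 2}"
    by (intro fundamental_theorem_of_calculus) auto
  then have "\<bar>integral {0..pi / 2} g\<bar> = \<bar>f (fst z) - f (snd z)\<bar>"
    by (simp add: integral_unique pair_rotation_def)
  then have "\<bar>f (fst z) - f (snd z)\<bar> powr p
      \<le> (pi / 2) powr (p - 1) * integral {0..pi / 2} (\<lambda>\<theta>. \<bar>g \<theta>\<bar> powr p)"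
    using powr_integral_le[OF _ p g] by simp
  moreover have "(\<integral>\<^sup>+\<theta>. ennreal (\<bar>g \<theta>\<bar> powr p) * indicator {0..pi / 2} \<theta> \<partial>lborel)
      = ennreal (integral {0..pi / 2} (\<lambda>\<theta>. \<bar>g \<theta>\<bar> powr p))"
    using p by (intro nn_integral_has_integral_lebesgue' integrable_integral
        integrable_continuous_real continuous_on_powr' continuous_intros g) auto
  ultimately show ?thesis
    unfolding g_def[symmetric] by (simp add: ennreal_mult'[symmetric] ennreal_leI)
qed

text \<open>After exchanging the integrals, the inner one does not depend on the angle, because rotations
  preserve both Lebesgue measure and the radial weight.\<close>
lemma nn_integral_rotation_average:
  fixes H :: "'a::euclidean_space \<times> 'a \<Rightarrow> ennreal" and w :: "real \<Rightarrow> ennreal"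
  assumes [measurable]: "H \<in> borel_measurable borel" "w \<in> borel_measurable borel" and L: "L \<ge> 0"
  shows "(\<integral>\<^sup>+z. w (norm z) * (\<integral>\<^sup>+\<theta>. H (pair_rotation \<theta> z) * indicator {0..L} \<theta> \<partial>lborel) \<partial>lborel)
    = ennreal L * (\<integral>\<^sup>+z. w (norm z) * H z \<partial>lborel)"
proof -
  have [measurable]: "(\<lambda>(z, \<theta>). H (pair_rotation \<theta> z)) \<in> borel_measurable (borel \<Otimes>\<^sub>M borel)"
    by measurable
  have "(\<integral>\<^sup>+z. w (norm z) * (\<integral>\<^sup>+\<theta>. H (pair_rotation \<theta> z) * indicator {0..L} \<theta> \<partial>lborel) \<partial>lborel)
    = (\<integral>\<^sup>+z. \<integral>\<^sup>+\<theta>. w (norm z) * (H (pair_rotation \<theta> z) * indicator {0..L} \<theta>) \<partial>lborel \<partial>lborel)"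
    by (subst nn_integral_cmult) auto
  also have "\<dots> = (\<integral>\<^sup>+\<theta>. \<integral>\<^sup>+z. w (norm z) * (H (pair_rotation \<theta> z) * indicator {0..L} \<theta>) \<partial>lborel \<partial>lborel)"
    by (intro lborel_pair.Fubini') measurable
  also have "\<dots> = (\<integral>\<^sup>+\<theta>. (\<integral>\<^sup>+z. w (norm z) * H z \<partial>lborel) * indicator {0..L} \<theta> \<partial>lborel)"
  proof (rule nn_integral_cong)
    fix \<theta> :: real
    have "(\<integral>\<^sup>+z. w (norm z) * (H (pair_rotation \<theta> z) * indicator {0..L} \<theta>) \<partial>lborel)
        = (\<integral>\<^sup>+z. w (norm (pair_rotation \<theta> z)) * H (pair_rotation \<theta> z) * indicator {0..L} \<theta> \<partial>lborel)"
      by (simp add: orthogonal_transformation_norm[OF orthogonal_transformation_pair_rotation] mult.assoc)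
    also have "\<dots> = (\<integral>\<^sup>+z. w (norm z) * H z * indicator {0..L} \<theta> \<partial>lborel)"
      by (rule nn_integral_lborel_orthogonal[OF orthogonal_transformation_pair_rotation]) measurable
    also have "\<dots> = (\<integral>\<^sup>+z. w (norm z) * H z \<partial>lborel) * indicator {0..L} \<theta>"
      by (rule nn_integral_multc) measurable
    finally show "(\<integral>\<^sup>+z. w (norm z) * (H (pair_rotation \<theta> z) * indicator {0..L} \<theta>) \<partial>lborel)
        = (\<integral>\<^sup>+z. w (norm z) * H z \<partial>lborel) * indicator {0..L} \<theta>" .
  qed
  also have "\<dots> = (\<integral>\<^sup>+z. w (norm z) * H z \<partial>lborel) * ennreal L"
    using L by (subst nn_integral_cmult) auto
  finally show ?thesis by (simp add: mult.commute)
qed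

section \<open>The inequality\<close>

lemma nn_integral_cauchy_measure:
  fixes F :: "'a::euclidean_space \<Rightarrow> ennreal"
  assumes [measurable]: "F \<in> borel_measurable borel"
  shows "(\<integral>\<^sup>+x. F x \<partial>cauchy_measure \<alpha>)
    = (\<integral>\<^sup>+x. ennreal ((1 + (norm x)\<^sup>2) powr (- \<alpha>) / cauchy_const DIM('a) \<alpha>) * F x \<partial>lborel)"
  unfolding cauchy_measure_def by (intro nn_integral_density) auto

lemma cauchy_const_pos: "real k / 2 < \<alpha> \<Longrightarrow> cauchy_const k \<alpha> > 0"
  unfolding cauchy_const_def
  by (intro divide_pos_pos mult_pos_pos Gamma_real_pos) (auto intro: le_less_trans[rotated])

text \<open>The moment of the slice, divided by one normalising constant and multiplied by the other, is
  the constant of the inequality: the values \<open>Gamma \<alpha>\<close> and \<open>Gamma \<beta>\<close> cancel.\<close>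
lemma cauchy_const_quotient:
  fixes n :: nat and p \<alpha> :: real
  assumes p: "0 < p" "p < 2 * (\<alpha> - real n)"
  shows "pi powr ((real n - 1) / 2) * Gamma ((p + 1) / 2) * Gamma (\<alpha> - (real n + p) / 2) / Gamma \<alpha>
      * cauchy_const n (\<alpha> - (real n + p) / 2) / cauchy_const (2 * n) \<alpha>
    = 1 / sqrt pi * (Gamma ((p + 1) / 2) * Gamma (\<alpha> - real n - p / 2) / Gamma (\<alpha> - real n))"
proof -
  define \<beta> where "\<beta> = \<alpha> - (real n + p) / 2"
  have b: "\<beta> > 0" "\<alpha> > 0" "\<alpha> - real n > 0"
    using p by (auto simp: \<beta>_def field_simps)
  have G: "Gamma \<beta> \<noteq> 0" "Gamma \<alpha> \<noteq> 0" "Gamma (\<alpha> - real n) \<noteq> 0"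
    using Gamma_real_pos[OF b(1)] Gamma_real_pos[OF b(2)] Gamma_real_pos[OF b(3)] by auto
  have e: "\<beta> - real n / 2 = \<alpha> - real n - p / 2"
    by (simp add: \<beta>_def field_simps)
  have "pi powr ((real n - 1) / 2) * pi powr (real n / 2) = pi powr (real n - 1 / 2)"
    by (simp add: powr_add[symmetric] field_simps)
  also have "\<dots> = pi powr real n / sqrt pi"
    by (simp add: powr_diff powr_half_sqrt)
  finally have pi: "pi powr ((real n - 1) / 2) * pi powr (real n / 2) = pi powr real n / sqrt pi" .
  have "pi powr ((real n - 1) / 2) * Gamma ((p + 1) / 2) * Gamma \<beta> / Gamma \<alpha>
      * cauchy_const n \<beta> / cauchy_const (2 * n) \<alpha>
    = (pi powr ((real n - 1) / 2) * pi powr (real n / 2)) / pi powr real n *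
      (Gamma ((p + 1) / 2) * Gamma (\<alpha> - real n - p / 2) / Gamma (\<alpha> - real n))"
    using G by (simp add: cauchy_const_def e field_simps)
  then show ?thesis
    unfolding pi \<beta>_def by simp
qed

theorem theorem2p3:
  fixes f :: "real ^ 'n \<Rightarrow> real" and \<alpha> p \<beta> C :: real
  assumes "\<alpha> > real CARD('n) + 1 / 2"
    and "1 \<le> p" and "p < 2 * (\<alpha> - real CARD('n))"
    and "smooth f"
    and "\<beta> = \<alpha> - (real CARD('n) + p) / 2"
    and "C = 1 / sqrt pi * (Gamma ((p + 1) / 2) * Gamma (\<alpha> - real CARD('n) - p / 2)
               / Gamma (\<alpha> - real CARD('n)))"
  shows "(\<integral>\<^sup>+ (x, y). ennreal (\<bar>f x - f y\<bar> powr p)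
            \<partial>(cauchy_measure \<alpha> :: ((real ^ 'n) \<times> (real ^ 'n)) measure))
         \<le> ennreal (C * (pi / 2) powr p)
            * (\<integral>\<^sup>+ x. ennreal (norm (gradient f x) powr p)
                 \<partial>(cauchy_measure \<beta> :: (real ^ 'n) measure))"
proof -
  define n where "n = CARD('n)"
  define c where "c = cauchy_const (2 * n) \<alpha>"
  define c' where "c' = cauchy_const n \<beta>"
  define K where "K = pi powr ((real n - 1) / 2) * Gamma ((p + 1) / 2)
        * Gamma (\<alpha> - (real n + p) / 2) / Gamma \<alpha>"
  define H where "H z = ennreal (\<bar>gradient f (fst z) \<bullet> snd z\<bar> powr p)" for z :: "(real ^ 'n) \<times> (real ^ 'n)"
  define w where "w r = ennreal ((1 + r\<^sup>2) powr (- \<alpha>) / c)" for r :: real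
  have c: "c > 0" unfolding c_def
    using assms by (intro cauchy_const_pos) (auto simp: n_def)
  have c': "c' > 0" unfolding c'_def
    using assms by (intro cauchy_const_pos) (auto simp: n_def field_simps)
  have C: "C = K * c' / c"
    using cauchy_const_quotient[of p \<alpha> n] assms by (simp add: K_def c_def c'_def n_def)
  have n\<alpha>: "\<alpha> > (real CARD('n) + p) / 2"
    using assms by (simp add: field_simps)
  have K: "K \<ge> 0"
    unfolding K_def using assms n\<alpha> by (auto simp: n_def intro!: divide_nonneg_nonneg mult_nonneg_nonneg less_imp_le[OF Gamma_real_pos])
  note grad = smooth_imp_continuous_gradient[OF assms(4)]
  have grad_m[measurable]: "gradient f \<in> borel_measurable borel"
    by (rule borel_measurable_continuous_onI[OF grad])
  have f_cont: "continuous_on UNIV f"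
    using assms(4) by (auto simp: smooth_def dest: spec[of _ 0])
  have f_m[measurable]: "f \<in> borel_measurable borel"
    by (rule borel_measurable_continuous_onI[OF f_cont])
  have pair_m: "h \<in> borel_measurable borel \<longleftrightarrow> h \<in> borel_measurable (borel \<Otimes>\<^sub>M borel)"
    for h :: "(real ^ 'n) \<times> (real ^ 'n) \<Rightarrow> ennreal"
    by (simp add: borel_prod)
  have H_m[measurable]: "H \<in> borel_measurable borel"
    unfolding pair_m H_def by measurable
  have w_m[measurable]: "w \<in> borel_measurable borel"
    unfolding w_def by measurable
  have "(\<integral>\<^sup>+ (x, y). ennreal (\<bar>f x - f y\<bar> powr p) \<partial>(cauchy_measure \<alpha> :: ((real ^ 'n) \<times> (real ^ 'n)) measure))
      = (\<integral>\<^sup>+z. w (norm z) * ennreal (\<bar>f (fst z) - f (snd z)\<bar> powr p) \<partial>lborel)"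
    unfolding case_prod_unfold
    by (subst nn_integral_cauchy_measure) (auto simp: pair_m w_def c_def n_def mult_2)
  also have "\<dots> \<le> (\<integral>\<^sup>+z. ennreal ((pi / 2) powr (p - 1)) *
      (w (norm z) * (\<integral>\<^sup>+\<theta>. H (pair_rotation \<theta> z) * indicator {0..pi / 2} \<theta> \<partial>lborel)) \<partial>lborel)"
    unfolding H_def mult.left_commute[of "ennreal ((pi / 2) powr (p - 1))"]
    by (intro nn_integral_mono mult_left_mono powr_diff_le_nn_integral_rotation assms) auto
  also have "\<dots> = ennreal ((pi / 2) powr (p - 1)) * (\<integral>\<^sup>+z. w (norm z) *
      (\<integral>\<^sup>+\<theta>. H (pair_rotation \<theta> z) * indicator {0..pi / 2} \<theta> \<partial>lborel) \<partial>lborel)"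
    by (rule nn_integral_cmult) measurable
  also have "\<dots> = ennreal ((pi / 2) powr (p - 1)) * (ennreal (pi / 2) * (\<integral>\<^sup>+z. w (norm z) * H z \<partial>lborel))"
    by (subst nn_integral_rotation_average) auto
  also have "\<dots> = ennreal ((pi / 2) powr p) * (\<integral>\<^sup>+z. w (norm z) * H z \<partial>lborel)"
    by (simp add: mult.assoc[symmetric] ennreal_mult'[symmetric] powr_diff)
  also have "(\<integral>\<^sup>+z. w (norm z) * H z \<partial>lborel) = (\<integral>\<^sup>+x. \<integral>\<^sup>+y. w (norm (x, y)) * H (x, y) \<partial>lborel \<partial>lborel)"
    by (subst lborel.nn_integral_fst) (simp_all add: lborel_prod)
  also have "\<dots> = (\<integral>\<^sup>+x. ennreal (K * c' / c) *
      (ennreal ((1 + (norm x)\<^sup>2) powr (- \<beta>) / c') * ennreal (norm (gradient f x) powr p)) \<partial>lborel)"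
  proof (rule nn_integral_cong)
    fix x :: "real ^ 'n"
    have u: "1 + (norm x)\<^sup>2 > 0" by (simp add: add_pos_nonneg)
    have "(\<integral>\<^sup>+y. w (norm (x, y)) * H (x, y) \<partial>lborel)
       = (\<integral>\<^sup>+y. ennreal (1 / c) * ennreal (\<bar>gradient f x \<bullet> y\<bar> powr p *
          ((1 + (norm x)\<^sup>2) + (norm y)\<^sup>2) powr (- \<alpha>)) \<partial>lborel)"
      using c by (intro nn_integral_cong)
        (simp add: w_def H_def norm_Pair ennreal_mult'[symmetric] add_nonneg_nonneg mult_ac add.assoc)
    also have "\<dots> = ennreal (1 / c) * (ennreal (norm (gradient f x) powr p * (1 + (norm x)\<^sup>2) powr (- \<beta>)) * ennreal K)"
      using assms by (subst nn_integral_cmult)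
        (auto simp: nn_integral_cauchy_slice[OF _ n\<alpha> u] K_def n_def)
    also have "\<dots> = ennreal (K * c' / c) *
        (ennreal ((1 + (norm x)\<^sup>2) powr (- \<beta>) / c') * ennreal (norm (gradient f x) powr p))"
      using c c' K by (simp add: ennreal_mult'[symmetric] mult_ac)
    finally show "(\<integral>\<^sup>+y. w (norm (x, y)) * H (x, y) \<partial>lborel) = \<dots>" .
  qed
  also have "\<dots> = ennreal C * (\<integral>\<^sup>+x. ennreal (norm (gradient f x) powr p)
      \<partial>(cauchy_measure \<beta> :: (real ^ 'n) measure))"
    by (subst nn_integral_cauchy_measure, measurable, subst nn_integral_cmult)
      (auto simp: C c'_def n_def)
  finally have "(\<integral>\<^sup>+ (x, y). ennreal (\<bar>f x - f y\<bar> powr p)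
      \<partial>(cauchy_measure \<alpha> :: ((real ^ 'n) \<times> (real ^ 'n)) measure))
    \<le> ennreal ((pi / 2) powr p) * (ennreal C * (\<integral>\<^sup>+x. ennreal (norm (gradient f x) powr p)
      \<partial>(cauchy_measure \<beta> :: (real ^ 'n) measure)))" .
  moreover have "ennreal (C * (pi / 2) powr p) = ennreal ((pi / 2) powr p) * ennreal C"
    by (simp add: mult.commute[of C] ennreal_mult')
  ultimately show ?thesis
    by (simp only: mult.assoc)
qed

end
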